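(* Let $n\ge1$ and $N\ge2$ be integers, let $2<p_j<\infty$ for $j=1,\dots,N$ with $\sum_{j=1}^N1/p_j=(N-1)/2$, and let $f_j\in\ell^{p_j,\infty}(\mathbb{Z}^n)$ be nonnegative sequences for $j=1,\dots,N$. Then the function $(\nu_1,\dots,\nu_N)\mapsto\prod_{j=1}^Nf_j(\nu_j)$ belongs to $\mathcal B_N((\mathbb{Z}^n)^N)$.
   Context: For $0<q<\infty$, $\ell^{q,\infty}(\mathbb{Z}^n)$ is the set of complex sequences $a=\{a_k\}_{k\in\mathbb{Z}^n}$ with $\|a\|_{\ell^{q,\infty}}=\sup_{t>0}\{t\,\sharp(\{k\in\mathbb{Z}^n:|a_k|>t\})^{1/q}\}<\infty$, where $\sharp$ denotes cardinality. $\mathcal B_N((\mathbb{Z}^n)^N)$ is the set of nonnegative functions $V$ on $(\mathbb{Z}^n)^N$ for which there is $c\in(0,\infty)$ such that $$\sum_{\nu_1,\dots,\nu_N\in\mathbb{Z}^n}V(\nu_1,\dots,\nu_N)A_0(\nu_1+\dots+\nu_N)\prod_{j=1}^NA_j(\nu_j)\le c\prod_{j=0}^N\|A_j\|_{\ell^2(\mathbb{Z}^n)}$$ for all nonnegative functions $A_0,\dots,A_N$ on $\mathbb{Z}^n$. *)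

theory Defs
  imports "HOL-Analysis.Analysis"
begin

(* Meant for r > 0 only, where \<infinity> to the power r is \<infinity>. *)
definition ennpowr :: "ennreal \<Rightarrow> real \<Rightarrow> ennreal"
  where "ennpowr x r = (if x = \<infinity> then \<infinity> else ennreal (enn2real x powr r))"

(* The counting measure is the cardinality with value \<infinity> on infinite sets
   (unlike card, which is 0 there). *)
definition weak_lnorm :: "real \<Rightarrow> ('k \<Rightarrow> complex) \<Rightarrow> ennreal"
  where "weak_lnorm q a =
    (SUP t\<in>{0<..}. ennreal t * ennpowr (emeasure (count_space UNIV) {k. cmod (a k) > t}) (1 / q))"

definition weak_lspace :: "real \<Rightarrow> ('k \<Rightarrow> complex) set"
  where "weak_lspace q = {a. weak_lnorm q a < \<infinity>}"

(* Extended-valued: \<infinity> for functions that are not square summable.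
   Infinite sums over ennreal always exist and are suprema of finite partial sums. *)
definition l2norm :: "('k \<Rightarrow> real) \<Rightarrow> ennreal"
  where "l2norm A = ennpowr (\<Sum>\<^sub>\<infinity>k. ennreal (\<bar>A k\<bar>\<^sup>2)) (1 / 2)"

(* Points of (Z^n)^N are functions {1..N} \<rightarrow>\<^sub>E UNIV; the values of V elsewhere are irrelevant.
   Some l2 norms on the right-hand side may be \<infinity>. In ennreal 0 * \<infinity> = 0, which is harmless:
   if the norm of some A j is 0, then A j = 0 and the left-hand side vanishes as well. *)
definition BN :: "nat \<Rightarrow> ((nat \<Rightarrow> int ^ 'n) \<Rightarrow> real) set"
  where "BN N = {V.
    (\<forall>\<nu> \<in> {1..N} \<rightarrow>\<^sub>E UNIV. V \<nu> \<ge> 0) \<and>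
    (\<exists>c::real. c > 0 \<and>
      (\<forall>A :: nat \<Rightarrow> int ^ 'n \<Rightarrow> real. (\<forall>j\<in>{0..N}. \<forall>k. A j k \<ge> 0) \<longrightarrow>
        (\<Sum>\<^sub>\<infinity>\<nu> \<in> {1..N} \<rightarrow>\<^sub>E UNIV.
            ennreal (V \<nu> * A 0 (\<Sum>j=1..N. \<nu> j) * (\<Prod>j=1..N. A j (\<nu> j))))
        \<le> ennreal c * (\<Prod>j=0..N. l2norm (A j))))}"

end

theory Submission
  imports Defs
begin

text \<open>
  Cut each \<open>f j\<close> into its level sets \<open>E j u = {2 powr (u / p j) \<le> f j < 2 powr ((u + 1) / p j)}\<close>,
  whose cardinality is \<open>O(2 powr (- u))\<close> by the weak type hypothesis, and let
  \<open>a j u\<close> be the \<open>\<ell>\<^sup>2\<close> norm of \<open>A j\<close> on \<open>E j u\<close>, so that \<open>a j\<close> is square summable with the same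
  norm as \<open>A j\<close> on the support of \<open>f j\<close>. On the block of levels \<open>(u j)\<^sub>j\<close>, the Cauchy-Schwarz inequality
  in \<open>\<nu> k\<close> against \<open>A 0\<close> and in every other \<open>\<nu> j\<close> against the constant \<open>1\<close> gives one bound for each \<open>k\<close>,
  losing \<open>sqrt (card (E j (u j)))\<close> for \<open>j \<noteq> k\<close>. Because all \<open>p j\<close> exceed \<open>2\<close>, the best of these bounds
  decays geometrically in the differences \<open>\<bar>u i - u j\<bar>\<close>, and Schur's test sums the blocks in \<open>\<ell>\<^sup>2\<close>.
  Everything happens over finite subsets, with constants that do not depend on them.
\<close>

section \<open>Sums over product sets and Cauchy-Schwarz on finite sets\<close>

lemma sum_PiE_insert:
  assumes "k \<notin> J"
  shows "(\<Sum>\<nu>\<in>Pi\<^sub>E (insert k J) E. g \<nu>) = (\<Sum>x\<in>E k. \<Sum>\<mu>\<in>Pi\<^sub>E J E. g (\<mu>(k := x)))"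
  unfolding PiE_insert_eq sum.reindex[OF inj_combinator[OF assms]] sum.cartesian_product
  by (simp add: case_prod_unfold)

lemma sum_mult_le_L2_set: "(\<Sum>i\<in>A. f i * g i) \<le> L2_set f A * L2_set g A"
  using L2_set_mult_ineq[of f g A]
  by (rule order_trans[rotated]) (auto intro!: sum_mono simp flip: abs_mult)

lemma L2_set_mono_subset:
  assumes "finite D" "E \<subseteq> D"
  shows "L2_set f E \<le> L2_set f D"
  unfolding L2_set_def using assms by (intro real_sqrt_le_mono sum_mono2) auto

lemma L2_set_translate_le:
  fixes f :: "'a::ab_group_add \<Rightarrow> real"
  assumes "finite D" "\<And>x. x \<in> E \<Longrightarrow> x + s \<in> D"
  shows "L2_set (\<lambda>x. f (x + s)) E \<le> L2_set f D"
proof -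
  have "L2_set (\<lambda>x. f (x + s)) E = L2_set f ((\<lambda>x. x + s) ` E)"
    unfolding L2_set_def by (subst sum.reindex) (auto simp: inj_on_def)
  also have "\<dots> \<le> L2_set f D"
    using assms by (intro L2_set_mono_subset) auto
  finally show ?thesis .
qed

lemma sum_le_sqrt_card_L2_set: "(\<Sum>x\<in>E. f x) \<le> sqrt (card E) * L2_set f E"
  using sum_mult_le_L2_set[of "\<lambda>_. 1" f E] by (simp add: L2_set_constant)

text \<open>With the coordinates other than \<open>k\<close> fixed, the argument of
  \<open>A0\<close> is a translate of the \<open>k\<close>-th coordinate, and translation is
  injective, so the norm of \<open>A0\<close> on \<open>D\<close> serves uniformly. What remains no
  longer couples the other coordinates.\<close>

lemma convolution_form_le:
  fixes E :: "'i \<Rightarrow> 'a::ab_group_add set" and A :: "'i \<Rightarrow> 'a \<Rightarrow> real"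
  assumes "finite I" "k \<in> I" and fin: "\<And>j. j \<in> I \<Longrightarrow> finite (E j)" and "finite D"
    and D: "\<And>\<nu>. \<nu> \<in> Pi\<^sub>E I E \<Longrightarrow> sum \<nu> I \<in> D"
    and A: "\<And>j x. j \<in> I \<Longrightarrow> A j x \<ge> 0"
  shows "(\<Sum>\<nu>\<in>Pi\<^sub>E I E. A0 (sum \<nu> I) * (\<Prod>j\<in>I. A j (\<nu> j)))
     \<le> L2_set A0 D * (\<Prod>j\<in>I. L2_set (A j) (E j)) * (\<Prod>j\<in>I - {k}. sqrt (card (E j)))"
proof -
  define J where "J = I - {k}"
  have J: "finite J" "k \<notin> J" and I: "I = insert k J"
    using assms(1,2) by (auto simp: J_def)
  have sum_upd: "sum (\<mu>(k := x)) J = sum \<mu> J" for \<mu> x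
    using J by (intro sum.cong) auto
  have prod_upd: "(\<Prod>j\<in>J. A j ((\<mu>(k := x)) j)) = (\<Prod>j\<in>J. A j (\<mu> j))" for \<mu> x
    using J by (intro prod.cong) auto
  have upd: "A0 (sum (\<mu>(k := x)) I) * (\<Prod>j\<in>I. A j ((\<mu>(k := x)) j))
      = (A0 (x + sum \<mu> J) * A k x) * (\<Prod>j\<in>J. A j (\<mu> j))" for \<mu> x
    unfolding I using J by (simp add: sum_upd prod_upd del: fun_upd_apply) simp
  \<comment> \<open>The \<open>k\<close>-th coordinate becomes the inner sum, where Cauchy-Schwarz
    is applied.\<close>
  have "(\<Sum>\<nu>\<in>Pi\<^sub>E I E. A0 (sum \<nu> I) * (\<Prod>j\<in>I. A j (\<nu> j)))
    = (\<Sum>\<mu>\<in>Pi\<^sub>E J E. \<Sum>x\<in>E k. (A0 (x + sum \<mu> J) * A k x) * (\<Prod>j\<in>J. A j (\<mu> j)))"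
    unfolding upd[symmetric] by (subst I, subst sum_PiE_insert[OF J(2)], rule sum.swap)
  also have "\<dots> \<le> (\<Sum>\<mu>\<in>Pi\<^sub>E J E. (L2_set A0 D * L2_set (A k) (E k)) * (\<Prod>j\<in>J. A j (\<mu> j)))"
    unfolding sum_distrib_right[symmetric]
  proof (intro sum_mono mult_right_mono prod_nonneg ballI)
    fix \<mu> assume \<mu>: "\<mu> \<in> Pi\<^sub>E J E"
    have "x + sum \<mu> J \<in> D" if "x \<in> E k" for x
    proof -
      have "\<mu>(k := x) \<in> Pi\<^sub>E I E" using \<mu> that unfolding I by (intro PiE_fun_upd)
      from D[OF this] show ?thesis unfolding I using J by (simp add: sum_upd del: fun_upd_apply) simp
    qed
    then have "L2_set (\<lambda>x. A0 (x + sum \<mu> J)) (E k) \<le> L2_set A0 D"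
      using \<open>finite D\<close> by (intro L2_set_translate_le)
    then show "(\<Sum>x\<in>E k. A0 (x + sum \<mu> J) * A k x) \<le> L2_set A0 D * L2_set (A k) (E k)"
      by (intro order_trans[OF sum_mult_le_L2_set] mult_right_mono) auto
  qed (use A I in auto)
  also have "\<dots> = L2_set A0 D * L2_set (A k) (E k) * (\<Prod>j\<in>J. \<Sum>x\<in>E j. A j x)"
    using J fin I by (subst prod_sum_PiE) (auto simp: sum_distrib_left)
  also have "\<dots> \<le> L2_set A0 D * L2_set (A k) (E k) * (\<Prod>j\<in>J. sqrt (card (E j)) * L2_set (A j) (E j))"
    using A I by (intro mult_left_mono prod_mono conjI sum_le_sqrt_card_L2_set sum_nonneg) auto
  also have "\<dots> = L2_set A0 D * (\<Prod>j\<in>I. L2_set (A j) (E j)) * (\<Prod>j\<in>I - {k}. sqrt (card (E j)))"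
    unfolding J_def[symmetric] using J by (simp add: I prod.distrib)
  finally show ?thesis .
qed

section \<open>Schur's test for geometrically decaying kernels\<close>

lemma sum_power_abs_diff_le:
  fixes r :: real and v :: int
  assumes "0 \<le> r" "r < 1" "finite U"
  shows "(\<Sum>w\<in>U. r ^ nat \<bar>v - w\<bar>) \<le> 2 / (1 - r)"
proof -
  \<comment> \<open>On either side of \<open>v\<close> the distance to \<open>v\<close> determines
    \<open>w\<close>, so each half is part of one geometric series.\<close>
  have geo: "(\<Sum>w\<in>W. r ^ nat \<bar>v - w\<bar>) \<le> 1 / (1 - r)"
    if "finite W" "inj_on (\<lambda>w. nat \<bar>v - w\<bar>) W" for W
  proof -
    have "(\<Sum>w\<in>W. r ^ nat \<bar>v - w\<bar>) = (\<Sum>n\<in>(\<lambda>w. nat \<bar>v - w\<bar>) ` W. r ^ n)"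
      using that by (simp add: sum.reindex)
    also have "\<dots> \<le> (\<Sum>n. r ^ n)"
      using that assms by (intro sum_le_suminf summable_geometric) auto
    finally show ?thesis using assms by (simp add: suminf_geometric)
  qed
  have "(\<Sum>w\<in>U. r ^ nat \<bar>v - w\<bar>)
    = (\<Sum>w\<in>{w\<in>U. w \<le> v}. r ^ nat \<bar>v - w\<bar>) + (\<Sum>w\<in>{w\<in>U. \<not> w \<le> v}. r ^ nat \<bar>v - w\<bar>)"
    using assms by (subst sum.union_disjoint[symmetric]) (auto intro: sum.cong)
  also have "\<dots> \<le> 1 / (1 - r) + 1 / (1 - r)"
    using assms by (intro add_mono geo) (auto simp: inj_on_def)
  finally show ?thesis by simp
qed

text \<open>Cauchy-Schwarz with the kernel split into two square roots bounds
  \<open>(b v)\<^sup>2\<close> by a row sum times a weighted sum of squares. Bounding the kernel by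
  \<open>1\<close> gives the pointwise estimate; summing over \<open>v\<close> and using column sums
  gives the estimate in l2.\<close>

lemma schur_test_power_abs_diff:
  fixes r :: real and a :: "int \<Rightarrow> real"
  assumes r: "0 \<le> r" "r < 1" and U: "finite U"
  defines "b \<equiv> \<lambda>v. \<Sum>w\<in>U. r ^ nat \<bar>v - w\<bar> * a w"
  shows "\<bar>b v\<bar> \<le> 2 / (1 - r) * L2_set a U" and "L2_set b U \<le> 2 / (1 - r) * L2_set a U"
proof -
  define K where "K = 2 / (1 - r)"
  have K: "K \<ge> 1" using r by (simp add: K_def field_simps)
  have b2: "(b v)\<^sup>2 \<le> K * (\<Sum>w\<in>U. r ^ nat \<bar>v - w\<bar> * (a w)\<^sup>2)" for v
  proof -
    have "b v = (\<Sum>w\<in>U. sqrt (r ^ nat \<bar>v - w\<bar>) * (sqrt (r ^ nat \<bar>v - w\<bar>) * a w))"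
      unfolding b_def using r by (intro sum.cong) (auto simp flip: mult.assoc)
    then have "(b v)\<^sup>2 \<le> (\<Sum>w\<in>U. (sqrt (r ^ nat \<bar>v - w\<bar>))\<^sup>2) * (\<Sum>w\<in>U. (sqrt (r ^ nat \<bar>v - w\<bar>) * a w)\<^sup>2)"
      using Cauchy_Schwarz_ineq_sum by simp
    also have "\<dots> = (\<Sum>w\<in>U. r ^ nat \<bar>v - w\<bar>) * (\<Sum>w\<in>U. r ^ nat \<bar>v - w\<bar> * (a w)\<^sup>2)"
      using r by (simp add: power_mult_distrib)
    also have "\<dots> \<le> K * (\<Sum>w\<in>U. r ^ nat \<bar>v - w\<bar> * (a w)\<^sup>2)"
      unfolding K_def using r U by (intro mult_right_mono sum_power_abs_diff_le sum_nonneg) auto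
    finally show ?thesis .
  qed
  have L2: "(L2_set a U)\<^sup>2 = (\<Sum>w\<in>U. (a w)\<^sup>2)"
    by (simp add: L2_set_def sum_nonneg)
  have "(b v)\<^sup>2 \<le> K * (\<Sum>w\<in>U. 1 * (a w)\<^sup>2)"
    using r K by (intro order_trans[OF b2] mult_left_mono sum_mono mult_right_mono power_le_one) auto
  also have "\<dots> \<le> K\<^sup>2 * (\<Sum>w\<in>U. (a w)\<^sup>2)"
    using K by (simp add: power2_eq_square mult_right_mono sum_nonneg)
  also have "\<dots> = (K * L2_set a U)\<^sup>2" by (simp add: L2 power_mult_distrib)
  finally show "\<bar>b v\<bar> \<le> 2 / (1 - r) * L2_set a U"
    unfolding K_def[symmetric] using K by (metis abs_le_square_iff abs_of_nonneg L2_set_nonneg mult_nonneg_nonneg order_trans zero_le_one)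
  have "(L2_set b U)\<^sup>2 = (\<Sum>v\<in>U. (b v)\<^sup>2)"
    by (simp add: L2_set_def sum_nonneg)
  also have "\<dots> \<le> (\<Sum>v\<in>U. K * (\<Sum>w\<in>U. r ^ nat \<bar>v - w\<bar> * (a w)\<^sup>2))"
    by (intro sum_mono b2)
  \<comment> \<open>The kernel is symmetric, so column sums obey the same bound as row sums.\<close>
  also have "\<dots> = K * (\<Sum>w\<in>U. (\<Sum>v\<in>U. r ^ nat \<bar>w - v\<bar>) * (a w)\<^sup>2)"
    unfolding sum_distrib_left[symmetric] sum_distrib_right
    by (subst sum.swap) (simp add: abs_minus_commute)
  also have "\<dots> \<le> K * (\<Sum>w\<in>U. K * (a w)\<^sup>2)"
    using K r U unfolding K_def
    by (intro mult_left_mono sum_mono mult_right_mono sum_power_abs_diff_le) auto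
  also have "\<dots> = (K * L2_set a U)\<^sup>2"
    unfolding power_mult_distrib L2 by (simp add: power2_eq_square sum_distrib_left mult_ac)
  finally have "(L2_set b U)\<^sup>2 \<le> (K * L2_set a U)\<^sup>2" .
  then show "L2_set b U \<le> 2 / (1 - r) * L2_set a U"
    unfolding K_def[symmetric] by (rule power2_le_imp_le) (use K in simp)
qed

text \<open>The kernel is a star centred at \<open>i\<close>: once \<open>u i = v\<close> is fixed,
  the other sums factor into \<open>b j v\<close>. Cauchy-Schwarz in \<open>v\<close> consumes
  \<open>a i\<close> and one factor \<open>b i'\<close>, each bounded in l2; the remaining factors
  are bounded pointwise. This is why two distinct indices are required.\<close>

lemma multilinear_schur_test:
  fixes r :: real and a :: "'i \<Rightarrow> int \<Rightarrow> real"
  assumes r: "0 \<le> r" "r < 1" and U: "finite U" and I: "finite I" "i \<in> I" "i' \<in> I" "i \<noteq> i'"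
    and a: "\<And>j u. j \<in> I \<Longrightarrow> a j u \<ge> 0"
  shows "(\<Sum>u\<in>Pi\<^sub>E I (\<lambda>_. U). (\<Prod>j\<in>I. r ^ nat \<bar>u i - u j\<bar>) * (\<Prod>j\<in>I. a j (u j)))
    \<le> (2 / (1 - r)) ^ (card I - 1) * (\<Prod>j\<in>I. L2_set (a j) U)"
proof -
  define J where "J = I - {i}"
  have J: "finite J" "i \<notin> J" "i' \<in> J" and IJ: "I = insert i J"
    using I by (auto simp: J_def)
  define K where "K = 2 / (1 - r)"
  have K: "K \<ge> 0" using r by (simp add: K_def)
  define b where "b j v = (\<Sum>w\<in>U. r ^ nat \<bar>v - w\<bar> * a j w)" for j v
  have b0: "b j v \<ge> 0" if "j \<in> I" for j v
    unfolding b_def using r a that by (intro sum_nonneg) auto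
  \<comment> \<open>The kernel factor at \<open>j = i\<close> is \<open>r ^ 0 = 1\<close>.\<close>
  have upd: "(\<Prod>j\<in>I. r ^ nat \<bar>(\<mu>(i := v)) i - (\<mu>(i := v)) j\<bar>) * (\<Prod>j\<in>I. a j ((\<mu>(i := v)) j))
      = a i v * (\<Prod>j\<in>J. r ^ nat \<bar>v - \<mu> j\<bar> * a j (\<mu> j))" for \<mu> v
  proof -
    have "(\<Prod>j\<in>J. r ^ nat \<bar>v - (\<mu>(i := v)) j\<bar> * a j ((\<mu>(i := v)) j))
      = (\<Prod>j\<in>J. r ^ nat \<bar>v - \<mu> j\<bar> * a j (\<mu> j))"
      using J by (intro prod.cong) auto
    then show ?thesis
      unfolding prod.distrib[symmetric] IJ using J by simp
  qed
  have "(\<Sum>u\<in>Pi\<^sub>E I (\<lambda>_. U). (\<Prod>j\<in>I. r ^ nat \<bar>u i - u j\<bar>) * (\<Prod>j\<in>I. a j (u j)))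
    = (\<Sum>v\<in>U. \<Sum>\<mu>\<in>Pi\<^sub>E J (\<lambda>_. U). a i v * (\<Prod>j\<in>J. r ^ nat \<bar>v - \<mu> j\<bar> * a j (\<mu> j)))"
    unfolding upd[symmetric] by (subst (1) IJ, subst sum_PiE_insert[OF J(2)]) simp
  also have "\<dots> = (\<Sum>v\<in>U. a i v * (\<Prod>j\<in>J. b j v))"
    unfolding b_def using J U by (subst prod_sum_PiE) (auto simp: sum_distrib_left)
  also have "\<dots> \<le> (\<Sum>v\<in>U. a i v * (b i' v * (\<Prod>j\<in>J - {i'}. K * L2_set (a j) U)))"
  proof (intro sum_mono mult_left_mono)
    fix v
    have "(\<Prod>j\<in>J. b j v) = b i' v * (\<Prod>j\<in>J - {i'}. b j v)"
      using J by (simp add: prod.remove)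
    also have "\<dots> \<le> b i' v * (\<Prod>j\<in>J - {i'}. K * L2_set (a j) U)"
    proof (intro mult_left_mono prod_mono conjI)
      fix j assume "j \<in> J - {i'}"
      then show "0 \<le> b j v" using b0 IJ by auto
      show "b j v \<le> K * L2_set (a j) U"
        using schur_test_power_abs_diff(1)[OF r U, where a = "a j" and v = v] unfolding b_def K_def by auto
    qed (use b0 I in auto)
    finally show "(\<Prod>j\<in>J. b j v) \<le> b i' v * (\<Prod>j\<in>J - {i'}. K * L2_set (a j) U)" .
  qed (use a I in auto)
  also have "\<dots> = (\<Sum>v\<in>U. a i v * b i' v) * (\<Prod>j\<in>J - {i'}. K * L2_set (a j) U)"
    by (simp add: sum_distrib_right mult.assoc)
  also have "\<dots> \<le> (L2_set (a i) U * (K * L2_set (a i') U)) * (\<Prod>j\<in>J - {i'}. K * L2_set (a j) U)"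
    using K schur_test_power_abs_diff(2)[OF r U, where a = "a i'"] unfolding b_def K_def
    by (intro mult_right_mono order_trans[OF sum_mult_le_L2_set] mult_left_mono prod_nonneg) auto
  also have "\<dots> = L2_set (a i) U * (\<Prod>j\<in>J. K * L2_set (a j) U)"
    using J by (simp add: prod.remove[of J i'])
  also have "\<dots> = K ^ (card I - 1) * (\<Prod>j\<in>I. L2_set (a j) U)"
    using J by (simp add: IJ prod.distrib)
  finally show ?thesis unfolding K_def .
qed

section \<open>Choice of the best bound and estimate of one block\<close>

text \<open>The exponent \<open>(1 / p j)\<^sub>j\<close> is a convex combination of the vertices of
  \<open>{x \<in> [0, 1/2]\<^sup>I. \<Sum>x = (card I - 1) / 2}\<close>, that is, of the points with one coordinate
  \<open>0\<close> and all others \<open>1/2\<close>. The best vertex \<open>k\<close> is the one where \<open>u\<close> is minimal; it gains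
  the distance of \<open>u k\<close> to a weighted mean of \<open>u\<close>.\<close>

lemma convex_weights_spread:
  fixes u p :: "'i \<Rightarrow> real"
  assumes I: "finite I" "i \<in> I" and p: "(\<Sum>j\<in>I. 1 / p j) = (real (card I) - 1) / 2"
    and \<delta>: "0 \<le> \<delta>" "\<And>j. j \<in> I \<Longrightarrow> \<delta> \<le> 1 / 2 - 1 / p j"
  obtains k where "k \<in> I"
    and "(\<Sum>j\<in>I. u j / p j) - (\<Sum>j\<in>I - {k}. u j / 2) \<le> - (\<delta> / card I) * (\<Sum>j\<in>I. \<bar>u i - u j\<bar>)"
proof -
  have "Min (u ` I) \<in> u ` I" using I by (intro Min_in) auto
  then obtain k where k: "k \<in> I" "u k = Min (u ` I)" by auto
  have kmin: "u k \<le> u j" if "j \<in> I" for j using I that unfolding k(2) by (intro Min_le) auto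
  define w where "w j = 1 / 2 - 1 / p j" for j
  have w: "\<delta> \<le> w j" if "j \<in> I" for j using \<delta>(2)[OF that] by (simp add: w_def)
  \<comment> \<open>The weights \<open>w j\<close> sum to \<open>1 / 2\<close>, so \<open>S\<close>
    is half the distance from the minimum \<open>u k\<close> to the weighted mean. It equals minus
    the exponent to be bounded.\<close>
  define S where "S = (\<Sum>j\<in>I. w j * (u j - u k))"
  have one: "\<delta> * (u m - u k) \<le> S" if "m \<in> I" for m
  proof -
    have "\<delta> * (u m - u k) \<le> w m * (u m - u k)"
      using w[OF that] kmin[OF that] by (intro mult_right_mono) auto
    also have "\<dots> \<le> S" unfolding S_def
      using I that kmin w \<delta>(1) by (intro member_le_sum[where f = "\<lambda>j. w j * (u j - u k)"] mult_nonneg_nonneg) (auto intro: order_trans)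
    finally show ?thesis .
  qed
  \<comment> \<open>Since \<open>u k\<close> is minimal, \<open>\<bar>u i - u j\<bar>\<close> is at
    most the larger of \<open>u i - u k\<close> and \<open>u j - u k\<close>.\<close>
  have "\<delta> * \<bar>u i - u j\<bar> \<le> S" if j: "j \<in> I" for j
  proof (cases "u i \<le> u j")
    case True
    then have "\<delta> * \<bar>u i - u j\<bar> \<le> \<delta> * (u j - u k)" using \<delta> kmin[OF I(2)] by (intro mult_left_mono) auto
    with one[OF j] show ?thesis by simp
  next
    case False
    then have "\<delta> * \<bar>u i - u j\<bar> \<le> \<delta> * (u i - u k)" using \<delta> kmin[OF j] by (intro mult_left_mono) auto
    with one[OF I(2)] show ?thesis by simp
  qed
  \<comment> \<open>Each of the \<open>card I\<close> differences is controlled by all of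
    \<open>S\<close>; adding them up costs the factor \<open>card I\<close> in the decay
    rate.\<close>
  then have "(\<Sum>j\<in>I. \<delta> * \<bar>u i - u j\<bar>) \<le> card I * S"
    using sum_bounded_above[of I "\<lambda>j. \<delta> * \<bar>u i - u j\<bar>" S] by simp
  then have le: "\<delta> / card I * (\<Sum>j\<in>I. \<bar>u i - u j\<bar>) \<le> S"
    using I by (subst times_divide_eq_left, subst pos_divide_le_eq)
      (auto simp: sum_distrib_left[symmetric] mult.commute card_gt_0_iff)
  have "S = (\<Sum>j\<in>I. u j / 2 - u j / p j - w j * u k)"
    unfolding S_def w_def by (simp add: left_diff_distrib right_diff_distrib)
  also have "\<dots> = (\<Sum>j\<in>I. u j / 2) - (\<Sum>j\<in>I. u j / p j) - (\<Sum>j\<in>I. w j) * u k"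
    by (simp add: sum_subtractf sum_distrib_right)
  also have "(\<Sum>j\<in>I. w j) = 1 / 2" unfolding w_def using p by (simp add: sum_subtractf diff_divide_distrib)
  also have "(\<Sum>j\<in>I. u j / 2) = u k / 2 + (\<Sum>j\<in>I - {k}. u j / 2)"
    using I k by (subst sum.remove[of _ k]) auto
  finally have "S = (\<Sum>j\<in>I - {k}. u j / 2) - (\<Sum>j\<in>I. u j / p j)" by simp
  with le k show ?thesis by (intro that[of k]) auto
qed

text \<open>The index from \<open>convex_weights_spread\<close> is the coordinate that
  \<open>convolution_form_le\<close> pairs with \<open>A0\<close>. Up to constants, every
  \<open>f j\<close> contributes \<open>2 powr (u j / p j)\<close> and every cardinality with
  \<open>j \<noteq> k\<close> contributes \<open>2 powr (- u j / 2)\<close>; the product has exactly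
  the exponent bounded there.\<close>

lemma level_block_le:
  fixes E :: "'i \<Rightarrow> 'a::ab_group_add set" and f A :: "'i \<Rightarrow> 'a \<Rightarrow> real" and u :: "'i \<Rightarrow> int"
  assumes I: "finite I" "i \<in> I"
    and p: "\<And>j. j \<in> I \<Longrightarrow> 1 \<le> p j" "(\<Sum>j\<in>I. 1 / p j) = (real (card I) - 1) / 2"
    and \<delta>: "0 \<le> \<delta>" "\<And>j. j \<in> I \<Longrightarrow> \<delta> \<le> 1 / 2 - 1 / p j"
    and fin: "\<And>j. j \<in> I \<Longrightarrow> finite (E j)" and "finite D"
    and D: "\<And>\<nu>. \<nu> \<in> Pi\<^sub>E I E \<Longrightarrow> sum \<nu> I \<in> D"
    and A: "\<And>j x. j \<in> I \<Longrightarrow> A j x \<ge> 0" "\<And>x. A0 x \<ge> 0"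
    and f: "\<And>j x. j \<in> I \<Longrightarrow> x \<in> E j \<Longrightarrow> 0 \<le> f j x \<and> f j x \<le> 2 powr ((u j + 1) / p j)"
    and C: "\<And>j. j \<in> I \<Longrightarrow> 1 \<le> C j" "\<And>j. j \<in> I \<Longrightarrow> card (E j) \<le> C j * 2 powr (- u j)"
  shows "(\<Sum>\<nu>\<in>Pi\<^sub>E I E. (\<Prod>j\<in>I. f j (\<nu> j)) * (A0 (sum \<nu> I) * (\<Prod>j\<in>I. A j (\<nu> j))))
     \<le> (\<Prod>j\<in>I. 2 * sqrt (C j)) * L2_set A0 D *
       ((\<Prod>j\<in>I. (2 powr (- (\<delta> / card I))) ^ nat \<bar>u i - u j\<bar>) * (\<Prod>j\<in>I. L2_set (A j) (E j)))"
proof -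
  obtain k where k: "k \<in> I" and kle: "(\<Sum>j\<in>I. u j / p j) - (\<Sum>j\<in>I - {k}. u j / 2)
      \<le> - (\<delta> / card I) * (\<Sum>j\<in>I. \<bar>real_of_int (u i) - u j\<bar>)"
    using convex_weights_spread[OF I p(2) \<delta>, of "\<lambda>j. real_of_int (u j)"] by blast
  have F: "2 powr ((u j + 1) / p j) \<le> 2 * 2 powr (u j / p j)" if "j \<in> I" for j
  proof -
    have "2 powr ((u j + 1) / p j) \<le> 2 powr (1 + u j / p j)"
      using p(1)[OF that] by (intro powr_mono) (auto simp: field_simps)
    then show ?thesis by (simp add: powr_add)
  qed
  have S: "sqrt (card (E j)) \<le> sqrt (C j) * 2 powr (- u j / 2)" if "j \<in> I" for j
  proof -
    have "sqrt (card (E j)) \<le> sqrt (C j * 2 powr (- u j))" using C(2)[OF that] by simp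
    also have "\<dots> = sqrt (C j) * 2 powr (- u j / 2)"
      using powr_half_sqrt_powr[of 2 "- real_of_int (u j)"] by (simp add: real_sqrt_mult)
    finally show ?thesis .
  qed
  define P where "P = (\<Prod>j\<in>I. 2 * 2 powr (u j / p j))"
  define L where "L = L2_set A0 D * (\<Prod>j\<in>I. L2_set (A j) (E j))"
  have L: "L \<ge> 0" unfolding L_def by (intro mult_nonneg_nonneg prod_nonneg) auto
  have P: "P \<ge> 0" unfolding P_def by (intro prod_nonneg) auto
  have "(\<Sum>\<nu>\<in>Pi\<^sub>E I E. (\<Prod>j\<in>I. f j (\<nu> j)) * (A0 (sum \<nu> I) * (\<Prod>j\<in>I. A j (\<nu> j))))
    \<le> (\<Sum>\<nu>\<in>Pi\<^sub>E I E. P * (A0 (sum \<nu> I) * (\<Prod>j\<in>I. A j (\<nu> j))))"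
    unfolding P_def
  proof (intro sum_mono mult_right_mono prod_mono mult_nonneg_nonneg prod_nonneg A conjI)
    fix \<nu> j assume "\<nu> \<in> Pi\<^sub>E I E" and j: "j \<in> I"
    then have x: "\<nu> j \<in> E j" by auto
    from f[OF j x] show "0 \<le> f j (\<nu> j)" by simp
    from f[OF j x] F[OF j] show "f j (\<nu> j) \<le> 2 * 2 powr (u j / p j)" by linarith
  qed
  also have "\<dots> = P * (\<Sum>\<nu>\<in>Pi\<^sub>E I E. A0 (sum \<nu> I) * (\<Prod>j\<in>I. A j (\<nu> j)))"
    by (simp add: sum_distrib_left)
  also have "\<dots> \<le> P * (L * (\<Prod>j\<in>I - {k}. sqrt (card (E j))))"
    unfolding L_def using P
    by (intro mult_left_mono convolution_form_le I(1) k fin \<open>finite D\<close> D A)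
  also have "\<dots> \<le> P * (L * ((\<Prod>j\<in>I. sqrt (C j)) * 2 powr - (\<Sum>j\<in>I - {k}. u j / 2)))"
  proof (intro mult_left_mono P L)
    have "(\<Prod>j\<in>I - {k}. sqrt (card (E j))) \<le> (\<Prod>j\<in>I - {k}. sqrt (C j) * 2 powr (- u j / 2))"
      using S by (intro prod_mono) auto
    also have "\<dots> = (\<Prod>j\<in>I - {k}. sqrt (C j)) * 2 powr - (\<Sum>j\<in>I - {k}. u j / 2)"
      by (simp add: prod.distrib powr_sum sum_negf[symmetric] I)
    \<comment> \<open>As \<open>C k \<ge> 1\<close>, the missing factor can be inserted; the
      constant is then independent of \<open>k\<close>, which varies with \<open>u\<close>.\<close>
    also have "\<dots> \<le> (\<Prod>j\<in>I. sqrt (C j)) * 2 powr - (\<Sum>j\<in>I - {k}. u j / 2)"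
      using C(1) k I
      by (intro mult_right_mono prod_mono2) (auto intro: order_trans[OF zero_le_one])
    finally show "(\<Prod>j\<in>I - {k}. sqrt (card (E j))) \<le> \<dots>" .
  qed
  also have "\<dots> = (\<Prod>j\<in>I. 2 * sqrt (C j)) * L * 2 powr ((\<Sum>j\<in>I. u j / p j) - (\<Sum>j\<in>I - {k}. u j / 2))"
    by (simp add: P_def prod.distrib powr_sum I powr_diff powr_minus field_simps)
  also have "\<dots> \<le> (\<Prod>j\<in>I. 2 * sqrt (C j)) * L * 2 powr (- (\<delta> / card I) * (\<Sum>j\<in>I. \<bar>real_of_int (u i) - u j\<bar>))"
  proof (intro mult_left_mono powr_mono kle mult_nonneg_nonneg L prod_nonneg ballI)
    fix j assume "j \<in> I"
    from C(1)[OF this] show "0 \<le> sqrt (C j)" by simp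
  qed auto
  also have "2 powr (- (\<delta> / card I) * (\<Sum>j\<in>I. \<bar>real_of_int (u i) - u j\<bar>))
    = (\<Prod>j\<in>I. 2 powr (- (\<delta> / card I) * real (nat \<bar>u i - u j\<bar>)))"
    by (simp add: sum_distrib_left powr_sum I)
  also have "\<dots> = (\<Prod>j\<in>I. (2 powr (- (\<delta> / card I))) ^ nat \<bar>u i - u j\<bar>)"
    by (simp only: powr_powr[symmetric] powr_realpow powr_gt_zero)
  finally show ?thesis unfolding L_def by (simp add: mult_ac)
qed

section \<open>Decomposition into level sets and summation of the blocks\<close>

lemma floor_log_level:
  fixes y p :: real and u :: int
  assumes "0 < y" "0 < p" "\<lfloor>p * log 2 y\<rfloor> = u"
  shows "2 powr (u / p) \<le> y" "y \<le> 2 powr ((u + 1) / p)"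
proof -
  have "u / p \<le> log 2 y" "log 2 y \<le> (u + 1) / p"
    using assms by (auto simp: field_simps floor_eq_iff)
  then show "2 powr (u / p) \<le> y" "y \<le> 2 powr ((u + 1) / p)"
    using assms by (auto simp: le_log_iff log_le_iff)
qed

text \<open>The constant is fixed before the finite sets and the functions \<open>A\<close>,
  \<open>A0\<close>: it depends only on \<open>I\<close>, \<open>p\<close> and \<open>C\<close>, so
  the bound can pass to infinite sums. \<open>D\<close> contains both the side \<open>B\<close> of
  the box and all coordinate sums, so a single set carries every norm.\<close>

lemma product_form_bound:
  fixes f :: "'i \<Rightarrow> 'a::ab_group_add \<Rightarrow> real"
  assumes I: "finite I" "i \<in> I" "i' \<in> I" "i \<noteq> i'"
    and p: "\<And>j. j \<in> I \<Longrightarrow> 2 < p j" "(\<Sum>j\<in>I. 1 / p j) = (real (card I) - 1) / 2"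
    and f: "\<And>j x. j \<in> I \<Longrightarrow> 0 \<le> f j x"
    and C: "\<And>j. j \<in> I \<Longrightarrow> 1 \<le> C j"
      "\<And>j t. j \<in> I \<Longrightarrow> 0 < t \<Longrightarrow> finite {x. f j x > t} \<and> card {x. f j x > t} \<le> C j * t powr (- p j)"
  obtains c where "c > 0"
    and "\<And>B D A A0. finite B \<Longrightarrow> finite D \<Longrightarrow> B \<subseteq> D \<Longrightarrow>
      (\<And>\<nu>. \<nu> \<in> Pi\<^sub>E I (\<lambda>_. B) \<Longrightarrow> sum \<nu> I \<in> D) \<Longrightarrow>
      (\<And>j x. j \<in> I \<Longrightarrow> A j x \<ge> 0) \<Longrightarrow> (\<And>x. A0 x \<ge> 0) \<Longrightarrow>
      (\<Sum>\<nu>\<in>Pi\<^sub>E I (\<lambda>_. B). (\<Prod>j\<in>I. f j (\<nu> j)) * (A0 (sum \<nu> I) * (\<Prod>j\<in>I. A j (\<nu> j))))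
        \<le> c * (L2_set A0 D * (\<Prod>j\<in>I. L2_set (A j) D))"
proof -
  \<comment> \<open>Positive because every \<open>p j\<close> exceeds \<open>2\<close>; this yields
    the decay ratio \<open>r < 1\<close> below.\<close>
  define \<delta> where "\<delta> = Min ((\<lambda>j. 1 / 2 - 1 / p j) ` I)"
  have "0 < 1 / 2 - 1 / p j" if "j \<in> I" for j using p(1)[OF that] by (auto simp: field_simps)
  then have \<delta>0: "\<delta> > 0" unfolding \<delta>_def using I by (subst Min_gr_iff) auto
  have \<delta>: "\<delta> \<le> 1 / 2 - 1 / p j" if "j \<in> I" for j
    unfolding \<delta>_def using I that by (intro Min_le) auto
  define r :: real where "r = 2 powr (- (\<delta> / card I))"
  have "0 < card I" using I by (auto simp: card_gt_0_iff)
  then have r: "0 \<le> r" "r < 1"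
    using \<delta>0 powr_less_mono[of "- (\<delta> / card I)" 0 2] by (simp_all add: r_def)
  \<comment> \<open>The constant \<open>2 * C j\<close> instead of \<open>C j\<close> is the one in
    the cardinality bound \<open>cardE\<close>.\<close>
  define Q where "Q = (\<Prod>j\<in>I. 2 * sqrt (2 * C j))"
  have Q: "Q > 0" unfolding Q_def
  proof (intro prod_pos ballI)
    fix j assume "j \<in> I"
    from C(1)[OF this] show "0 < 2 * sqrt (2 * C j)" by simp
  qed
  define K where "K = (2 / (1 - r)) ^ (card I - 1)"
  have K: "K > 0" using r by (simp add: K_def)
  show ?thesis
  proof (rule that[of "Q * K"])
    show "Q * K > 0" using Q K by simp
    fix B D :: "'a set" and A :: "'i \<Rightarrow> 'a \<Rightarrow> real" and A0 :: "'a \<Rightarrow> real"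
    assume B: "finite B" and D: "finite D" "B \<subseteq> D"
      and sums: "\<And>\<nu>. \<nu> \<in> Pi\<^sub>E I (\<lambda>_. B) \<Longrightarrow> sum \<nu> I \<in> D"
      and A: "\<And>j x. j \<in> I \<Longrightarrow> A j x \<ge> 0" "\<And>x. A0 x \<ge> 0"
    define l where "l j x = \<lfloor>p j * log 2 (f j x)\<rfloor>" for j x
    \<comment> \<open>Zeros of \<open>f j\<close> belong to no level and are removed before the
      logarithm is used.\<close>
    define B' where "B' j = {x \<in> B. 0 < f j x}" for j
    have B': "finite (B' j)" "B' j \<subseteq> B" for j using B by (auto simp: B'_def)
    define E where "E j v = {x \<in> B' j. l j x = v}" for j v
    have E: "finite (E j v)" "E j v \<subseteq> B" for j v using B' by (auto simp: E_def)
    define U where "U = (\<Union>j\<in>I. l j ` B)"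
    have U: "finite U" using B I by (auto simp: U_def)
    have lU: "l j x \<in> U" if "j \<in> I" "x \<in> B' j" for j x
      using that B'(2)[of j] unfolding U_def by blast
    define T where "T \<nu> = (\<Prod>j\<in>I. f j (\<nu> j)) * (A0 (sum \<nu> I) * (\<Prod>j\<in>I. A j (\<nu> j)))" for \<nu>
    define a where "a j v = L2_set (A j) (E j v)" for j v
    have level: "2 powr (v / p j) \<le> f j x" "f j x \<le> 2 powr ((v + 1) / p j)"
      if "j \<in> I" "x \<in> E j v" for j v x
      using floor_log_level[of "f j x" "p j" v] p(1)[OF that(1)] that(2)
      by (auto simp: E_def B'_def l_def)
    have cardE: "card (E j v) \<le> 2 * C j * 2 powr (- v)" if j: "j \<in> I" for j and v :: int
    proof -
      \<comment> \<open>The hypothesis concerns the strict set \<open>f j x > t\<close>, while a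
        level set includes its lower endpoint. Lowering \<open>v\<close> by one makes the inequality
        strict and costs a factor \<open>2\<close>.\<close>
      define t where "t = 2 powr ((real_of_int v - 1) / p j)"
      have t: "t > 0" by (simp add: t_def)
      have "t < 2 powr (v / p j)"
        unfolding t_def using p(1)[OF j] by (intro powr_less_mono) (auto simp: field_simps)
      then have "E j v \<subseteq> {x. f j x > t}" using level(1)[OF j] by force
      then have "card (E j v) \<le> card {x. f j x > t}" using C(2)[OF j t] by (intro card_mono) auto
      also have "\<dots> \<le> C j * t powr (- p j)" using C(2)[OF j t] by simp
      also have "t powr (- p j) = 2 powr (1 - v)" using p(1)[OF j] by (simp add: t_def powr_powr)
      also have "\<dots> = 2 * 2 powr (- v)" by (simp add: powr_diff powr_minus divide_inverse)
      finally show ?thesis by simp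
    qed
    have block: "sum T {\<nu> \<in> Pi\<^sub>E I B'. (\<lambda>j\<in>I. l j (\<nu> j)) = u}
        \<le> Q * L2_set A0 D * ((\<Prod>j\<in>I. r ^ nat \<bar>u i - u j\<bar>) * (\<Prod>j\<in>I. a j (u j)))"
      if u: "u \<in> Pi\<^sub>E I (\<lambda>_. U)" for u
    proof -
      \<comment> \<open>The level vector restricted to \<open>I\<close> is extensional, as is
        \<open>u\<close>, so equality only concerns coordinates in \<open>I\<close> and the fibre is
        a product of level sets.\<close>
      have "{\<nu> \<in> Pi\<^sub>E I B'. (\<lambda>j\<in>I. l j (\<nu> j)) = u} = Pi\<^sub>E I (\<lambda>j. E j (u j))"
      proof (intro set_eqI iffI)
        fix \<nu> assume "\<nu> \<in> Pi\<^sub>E I (\<lambda>j. E j (u j))"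
        then show "\<nu> \<in> {\<nu> \<in> Pi\<^sub>E I B'. (\<lambda>j\<in>I. l j (\<nu> j)) = u}"
          using u by (auto simp: E_def PiE_iff fun_eq_iff extensional_def)
      qed (auto simp: E_def PiE_iff)
      moreover have "sum T (Pi\<^sub>E I (\<lambda>j. E j (u j))) \<le> Q * L2_set A0 D * ((\<Prod>j\<in>I. r ^ nat \<bar>u i - u j\<bar>) * (\<Prod>j\<in>I. a j (u j)))"
        unfolding T_def Q_def r_def a_def
      proof (rule level_block_le[where p = p])
        show "1 \<le> p j" "1 \<le> 2 * C j" if "j \<in> I" for j using p(1)[OF that] C(1)[OF that] by auto
        show "sum \<nu> I \<in> D" if "\<nu> \<in> Pi\<^sub>E I (\<lambda>j. E j (u j))" for \<nu>
          using that PiE_mono[of I "\<lambda>j. E j (u j)" "\<lambda>_. B"] E(2) by (intro sums) auto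
        show "0 \<le> f j x \<and> f j x \<le> 2 powr ((u j + 1) / p j)" if "j \<in> I" "x \<in> E j (u j)" for j x
          using f level(2) that by auto
      qed (use I p(2) \<delta>0 \<delta> E D A cardE in auto)
      ultimately show ?thesis by simp
    qed
    have "sum T (Pi\<^sub>E I (\<lambda>_. B)) = sum T (Pi\<^sub>E I B')"
    proof (rule sum.mono_neutral_right)
      show "finite (Pi\<^sub>E I (\<lambda>_. B))" using I B by (intro finite_PiE) auto
      show "Pi\<^sub>E I B' \<subseteq> Pi\<^sub>E I (\<lambda>_. B)" using B' by (intro PiE_mono) auto
      show "\<forall>\<nu>\<in>Pi\<^sub>E I (\<lambda>_. B) - Pi\<^sub>E I B'. T \<nu> = 0"
      proof
        fix \<nu> assume "\<nu> \<in> Pi\<^sub>E I (\<lambda>_. B) - Pi\<^sub>E I B'"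
        then obtain j where "j \<in> I" "\<not> 0 < f j (\<nu> j)" by (auto simp: PiE_iff B'_def)
        with f have "\<exists>j\<in>I. f j (\<nu> j) = 0" by (metis less_eq_real_def)
        then show "T \<nu> = 0" using I by (simp add: T_def)
      qed
    qed
    \<comment> \<open>Group the points of the box by their level vector.\<close>
    also have "\<dots> = (\<Sum>u\<in>Pi\<^sub>E I (\<lambda>_. U). sum T {\<nu> \<in> Pi\<^sub>E I B'. (\<lambda>j\<in>I. l j (\<nu> j)) = u})"
      using I B' U by (intro sum.group[symmetric] finite_PiE) (auto simp: PiE_iff intro!: lU)
    also have "\<dots> \<le> (\<Sum>u\<in>Pi\<^sub>E I (\<lambda>_. U). Q * L2_set A0 D * ((\<Prod>j\<in>I. r ^ nat \<bar>u i - u j\<bar>) * (\<Prod>j\<in>I. a j (u j))))"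
      by (intro sum_mono block)
    also have "\<dots> = Q * L2_set A0 D * (\<Sum>u\<in>Pi\<^sub>E I (\<lambda>_. U). (\<Prod>j\<in>I. r ^ nat \<bar>u i - u j\<bar>) * (\<Prod>j\<in>I. a j (u j)))"
      by (simp add: sum_distrib_left)
    also have "\<dots> \<le> Q * L2_set A0 D * (K * (\<Prod>j\<in>I. L2_set (a j) U))"
      unfolding K_def using Q r U I
      by (intro mult_left_mono multilinear_schur_test[where i' = i']) (auto simp: a_def)
    also have "\<dots> \<le> Q * L2_set A0 D * (K * (\<Prod>j\<in>I. L2_set (A j) D))"
    proof (intro mult_left_mono prod_mono conjI)
      fix j assume j: "j \<in> I"
      \<comment> \<open>The level sets partition \<open>B' j\<close>, so the squared norms on them
        add up without loss.\<close>
      have "(\<Sum>v\<in>U. (a j v)\<^sup>2) = (\<Sum>v\<in>U. \<Sum>x\<in>E j v. (A j x)\<^sup>2)"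
        by (simp add: a_def L2_set_def sum_nonneg)
      also have "\<dots> = (\<Sum>x\<in>B' j. (A j x)\<^sup>2)"
        unfolding E_def using B' U lU[OF j] by (intro sum.group) auto
      finally have "L2_set (a j) U = L2_set (A j) (B' j)" by (simp add: L2_set_def)
      then show "L2_set (a j) U \<le> L2_set (A j) D"
        using D B'(2)[of j] by (simp add: L2_set_mono_subset)
    qed (use Q K in auto)
    finally show "(\<Sum>\<nu>\<in>Pi\<^sub>E I (\<lambda>_. B). (\<Prod>j\<in>I. f j (\<nu> j)) * (A0 (sum \<nu> I) * (\<Prod>j\<in>I. A j (\<nu> j))))
        \<le> Q * K * (L2_set A0 D * (\<Prod>j\<in>I. L2_set (A j) D))"
      unfolding T_def by (simp add: mult_ac)
  qed
qed

section \<open>From the extended-valued norms to real bounds on finite sets\<close>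

text \<open>Raise the bound \<open>M\<close> on the weak norm to the power \<open>q\<close>. The
  maximum with \<open>1\<close> provides the condition \<open>1 \<le> C\<close> that
  \<open>level_block_le\<close> relies on.\<close>

lemma weak_lspace_card_bound:
  assumes "a \<in> weak_lspace q" "0 < q"
  obtains C where "1 \<le> C"
    and "\<And>t. 0 < t \<Longrightarrow> finite {k. cmod (a k) > t} \<and> card {k. cmod (a k) > t} \<le> C * t powr (- q)"
proof -
  have "weak_lnorm q a < \<infinity>" using assms by (simp add: weak_lspace_def)
  then obtain M where M: "0 \<le> M" "weak_lnorm q a = ennreal M"
    by (cases "weak_lnorm q a" rule: ennreal_cases) auto
  show ?thesis
  proof (rule that[of "max 1 (M powr q)"])
    fix t :: real assume t: "0 < t"
    let ?S = "{k. cmod (a k) > t}"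
    have le: "ennreal t * ennpowr (emeasure (count_space UNIV) ?S) (1 / q) \<le> ennreal M"
      unfolding M(2)[symmetric] weak_lnorm_def using t by (intro SUP_upper) auto
    have fin: "finite ?S"
    proof (rule ccontr)
      \<comment> \<open>An infinite set would make the supremum infinite, because
        \<open>t > 0\<close>.\<close>
      assume "infinite ?S"
      with le t show False by (simp add: ennpowr_def ennreal_mult_top top_unique)
    qed
    then have "ennreal (t * real (card ?S) powr (1 / q)) \<le> ennreal M"
      using le t by (simp add: ennpowr_def ennreal_mult ennreal_of_nat_eq_real_of_nat)
    then have "real (card ?S) powr (1 / q) \<le> M / t"
      using M t by (simp add: field_simps)
    then have "(real (card ?S) powr (1 / q)) powr q \<le> (M / t) powr q"
      using assms by (intro powr_mono2) auto
    also have "(M / t) powr q = M powr q * t powr (- q)"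
      using M t by (simp add: powr_divide powr_minus_divide)
    finally have "card ?S \<le> M powr q * t powr (- q)"
      using assms by (simp add: powr_powr)
    also have "\<dots> \<le> max 1 (M powr q) * t powr (- q)" by (intro mult_right_mono) auto
    finally show "finite ?S \<and> card ?S \<le> max 1 (M powr q) * t powr (- q)" using fin by simp
  qed simp
qed

lemma L2_set_le_l2norm:
  assumes D: "finite D"
  shows "ennreal (L2_set A D) \<le> l2norm A"
proof -
  let ?s = "\<Sum>\<^sub>\<infinity>k. ennreal (\<bar>A k\<bar>\<^sup>2)"
  have le: "ennreal (\<Sum>k\<in>D. (A k)\<^sup>2) \<le> ?s"
  proof -
    have "ennreal (\<Sum>k\<in>D. (A k)\<^sup>2) = infsum (\<lambda>k. ennreal (\<bar>A k\<bar>\<^sup>2)) D"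
      using D by (simp add: sum_ennreal)
    also have "\<dots> \<le> ?s" by (intro infsum_mono_neutral nonneg_summable_on_complete) auto
    finally show ?thesis .
  qed
  show ?thesis
  proof (cases "?s = \<infinity>")
    case False
    then obtain M where M: "0 \<le> M" "?s = ennreal M" by (cases ?s rule: ennreal_cases) auto
    then have "(\<Sum>k\<in>D. (A k)\<^sup>2) \<le> M" using le by (simp add: sum_nonneg)
    then show ?thesis using M by (simp add: l2norm_def ennpowr_def L2_set_def powr_half_sqrt ennreal_leI)
  qed (simp add: l2norm_def ennpowr_def)
qed

section \<open>Passage from finite boxes to the infinite sum\<close>

theorem proposition3p4:
  fixes N :: nat
    and p :: "nat \<Rightarrow> real"
    and f :: "nat \<Rightarrow> int ^ 'n \<Rightarrow> real"
  assumes "N \<ge> 2"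
    and "\<And>j. j \<in> {1..N} \<Longrightarrow> 2 < p j"
    and "(\<Sum>j=1..N. 1 / p j) = (real N - 1) / 2"
    and "\<And>j k. j \<in> {1..N} \<Longrightarrow> f j k \<ge> 0"
    and "\<And>j. j \<in> {1..N} \<Longrightarrow> (\<lambda>k. complex_of_real (f j k)) \<in> weak_lspace (p j)"
  shows "(\<lambda>\<nu>. \<Prod>j=1..N. f j (\<nu> j)) \<in> BN N"
proof -
  define I where "I = {1..N}"
  have "\<exists>C. 1 \<le> C \<and> (\<forall>t>0. finite {x. f j x > t} \<and> card {x. f j x > t} \<le> C * t powr (- p j))"
    if j: "j \<in> I" for j
  proof -
    have "0 < p j" using assms(2)[of j] j by (auto simp: I_def)
    moreover have "cmod (complex_of_real (f j k)) = f j k" for k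
      using assms(4)[of j k] j by (simp add: I_def)
    moreover have "(\<lambda>k. complex_of_real (f j k)) \<in> weak_lspace (p j)"
      using assms(5) j by (simp add: I_def)
    ultimately show ?thesis
      by (elim weak_lspace_card_bound) auto
  qed
  then obtain C where C: "\<And>j. j \<in> I \<Longrightarrow> 1 \<le> C j"
      "\<And>j t. j \<in> I \<Longrightarrow> 0 < t \<Longrightarrow> finite {x. f j x > t} \<and> card {x. f j x > t} \<le> C j * t powr (- p j)"
    by metis
  obtain c where c: "c > 0" and bound: "\<And>B D A A0. finite B \<Longrightarrow> finite D \<Longrightarrow> B \<subseteq> D \<Longrightarrow>
      (\<And>\<nu>. \<nu> \<in> Pi\<^sub>E I (\<lambda>_. B) \<Longrightarrow> sum \<nu> I \<in> D) \<Longrightarrow>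
      (\<And>j x. j \<in> I \<Longrightarrow> A j x \<ge> 0) \<Longrightarrow> (\<And>x. A0 x \<ge> 0) \<Longrightarrow>
      (\<Sum>\<nu>\<in>Pi\<^sub>E I (\<lambda>_. B). (\<Prod>j\<in>I. f j (\<nu> j)) * (A0 (sum \<nu> I) * (\<Prod>j\<in>I. A j (\<nu> j))))
        \<le> c * (L2_set A0 D * (\<Prod>j\<in>I. L2_set (A j) D))"
  \<comment> \<open>\<open>N \<ge> 2\<close> supplies the two distinct indices \<open>1\<close> and
    \<open>2\<close>.\<close>
  proof (rule product_form_bound[of I 1 2 p f C])
    show "(\<Sum>j\<in>I. 1 / p j) = (real (card I) - 1) / 2"
      using assms(3) by (simp add: I_def)
  qed (use assms(1,2,4) C in \<open>auto simp: I_def\<close>)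
  have "(\<Sum>\<^sub>\<infinity>\<nu> \<in> I \<rightarrow>\<^sub>E UNIV.
            ennreal ((\<Prod>j\<in>I. f j (\<nu> j)) * A 0 (\<Sum>j\<in>I. \<nu> j) * (\<Prod>j\<in>I. A j (\<nu> j))))
        \<le> ennreal c * (\<Prod>j=0..N. l2norm (A j))"
    if A: "\<forall>j\<in>{0..N}. \<forall>k. A j k \<ge> 0" for A :: "nat \<Rightarrow> int ^ 'n \<Rightarrow> real"
  proof (intro infsum_le_finite_sums nonneg_summable_on_complete)
    fix F :: "(nat \<Rightarrow> int ^ 'n) set"
    assume F: "finite F" "F \<subseteq> I \<rightarrow>\<^sub>E UNIV"
    \<comment> \<open>\<open>B\<close> collects all coordinates occurring in \<open>F\<close>, so
      \<open>F\<close> lies in a finite box; \<open>D\<close> adds the points at which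
      \<open>A 0\<close> is evaluated on that box.\<close>
    define B where "B = (\<Union>\<nu>\<in>F. \<nu> ` I)"
    define D where "D = B \<union> (\<lambda>\<nu>. sum \<nu> I) ` Pi\<^sub>E I (\<lambda>_. B)"
    have I: "finite I" by (simp add: I_def)
    have B: "finite B" using F I by (auto simp: B_def)
    have finP: "finite (Pi\<^sub>E I (\<lambda>_. B))" using B I by (intro finite_PiE) auto
    have D: "finite D" "B \<subseteq> D" using B finP by (auto simp: D_def)
    have FB: "F \<subseteq> Pi\<^sub>E I (\<lambda>_. B)" using F by (auto simp: B_def PiE_iff)
    have A': "A j x \<ge> 0" "A 0 x \<ge> 0" if "j \<in> I" for j x using A that by (auto simp: I_def)
    define T where "T \<nu> = (\<Prod>j\<in>I. f j (\<nu> j)) * A 0 (\<Sum>j\<in>I. \<nu> j) * (\<Prod>j\<in>I. A j (\<nu> j))" for \<nu>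
    have T: "T \<nu> \<ge> 0" for \<nu>
      unfolding T_def using A assms(4) by (intro mult_nonneg_nonneg prod_nonneg) (auto simp: I_def)
    have "(\<Sum>\<nu>\<in>F. ennreal (T \<nu>)) = ennreal (sum T F)"
      using T by (simp add: sum_ennreal)
    also have "sum T F \<le> sum T (Pi\<^sub>E I (\<lambda>_. B))"
      using FB finP T by (intro sum_mono2) auto
    also have "\<dots> \<le> c * (L2_set (A 0) D * (\<Prod>j\<in>I. L2_set (A j) D))"
      unfolding T_def mult.assoc
      by (rule bound) (use B D A in \<open>auto simp: D_def I_def\<close>)
    also have "\<dots> = c * (\<Prod>j=0..N. L2_set (A j) D)"
      by (simp add: I_def prod.atLeast_Suc_atMost)
    also have "ennreal \<dots> = ennreal c * (\<Prod>j=0..N. ennreal (L2_set (A j) D))"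
      using c by (simp add: ennreal_mult prod_nonneg prod_ennreal)
    also have "\<dots> \<le> ennreal c * (\<Prod>j=0..N. l2norm (A j))"
      using D by (intro mult_left_mono prod_mono_ennreal L2_set_le_l2norm) auto
    finally show "(\<Sum>\<nu>\<in>F. ennreal ((\<Prod>j\<in>I. f j (\<nu> j)) * A 0 (\<Sum>j\<in>I. \<nu> j) * (\<Prod>j\<in>I. A j (\<nu> j))))
      \<le> ennreal c * (\<Prod>j=0..N. l2norm (A j))"
      by (simp add: T_def ennreal_leI)
  qed simp
  then show ?thesis
    unfolding BN_def I_def using c assms(4) by (auto intro!: prod_nonneg exI[of _ c])
qed

end
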